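(* Let $H$ be a complex Hilbert space, let $\Omega\subset H$ be open and let $u\in\mathcal{PSH}(\Omega)\cap C^2(\Omega)$. Assume that there exists a unit vector $x\in H$ such that \[ \langle D'D''u(a)x,x\rangle=0\qquad\text{for all }a\in\Omega . \] Then $u$ is maximal in $\Omega$.
   Context: The inner product of $H$ is linear in the first variable. Plurisubharmonic: for $\Omega\subset H$ open, $\mathcal{PSH}(\Omega)$ is the set of upper semicontinuous $u:\Omega\to[-\infty,\infty)$, not identically $-\infty$ on any component of $\Omega$, such that $u(z)\le\frac1{2\pi}\int_0^{2\pi}u(z+e^{i\theta}h)\,d\theta$ whenever $z\in\Omega$, $h\in H$ and $z+\lambda h\in\Omega$ for all $|\lambda|\le1$. Levi form: for $u\in C^2(\Omega)$ with second real Fréchet differential $D^2u(a)$, $4D'D''u(a)(s,t)=D^2u(a)(s,t)+D^2u(a)(is,it)+iD^2u(a)(s,it)-iD^2u(a)(is,t)$; this form is identified with the bounded operator $D'D''u(a)$ on $H$ given by $\langle D'D''u(a)s,t\rangle=D'D''u(a)(s,t)$ (so $D'D''\|z\|^2=I$). For $u$ plurisubharmonic this operator is positive. Maximal: $G\Subset\Omega$ means $G$ is a bounded open set with $\overline G\subset\Omega$ (no compactness of $\overline G$). $u\in\mathcal{PSH}(\Omega)$ is maximal in $\Omega$ if for every bounded open $G\Subset\Omega$ and every $v\in\mathcal{PSH}(G)$ with $\limsup_{z\to\xi}v(z)\le u(\xi)$ for all $\xi\in\partial G$, one has $v\le u$ on $G$. *)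

theory Defs
  imports "HOL-Analysis.Analysis"
begin

class complex_vector = real_vector +
  fixes scaleC :: "complex \<Rightarrow> 'a \<Rightarrow> 'a" (infixr "*\<^sub>C" 75)
  assumes scaleC_add_right: "c *\<^sub>C (x + y) = c *\<^sub>C x + c *\<^sub>C y"
    and scaleC_add_left: "(c + d) *\<^sub>C x = c *\<^sub>C x + d *\<^sub>C x"
    and scaleC_scaleC: "c *\<^sub>C d *\<^sub>C x = (c * d) *\<^sub>C x"
    and scaleR_scaleC: "r *\<^sub>R x = complex_of_real r *\<^sub>C x"

text \<open>The real inner product inherited from \<^class>\<open>real_inner\<close> is the real part of the
  complex one, so that the norm is the one induced by the complex inner product. Positive
  definiteness of \<open>cinner\<close> follows from this together with conjugate symmetry.\<close>

class complex_hilbert_space = complex_vector + real_inner + complete_space +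
  fixes cinner :: "'a \<Rightarrow> 'a \<Rightarrow> complex"
  assumes cinner_commute: "cinner x y = cnj (cinner y x)"
    and cinner_add_left: "cinner (x + y) z = cinner x z + cinner y z"
    and cinner_scaleC_left: "cinner (c *\<^sub>C x) y = c * cinner x y"
    and inner_eq_Re_cinner: "inner x y = Re (cinner x y)"

definition bounded_clinear :: "('a::complex_hilbert_space \<Rightarrow> 'a) \<Rightarrow> bool" where
  "bounded_clinear T \<longleftrightarrow> bounded_linear T \<and> (\<forall>c x. T (c *\<^sub>C x) = c *\<^sub>C T x)"

text \<open>Real Frechet derivative as a bounded operator, so that it can be differentiated again
  with respect to the operator norm.\<close>

definition frechet_D ::
    "('a::real_normed_vector \<Rightarrow> 'b::real_normed_vector) \<Rightarrow> 'a \<Rightarrow> 'a \<Rightarrow>\<^sub>L 'b" where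
  "frechet_D f a = Blinfun (frechet_derivative f (at a))"

definition C2_on :: "'a::real_normed_vector set \<Rightarrow> ('a \<Rightarrow> real) \<Rightarrow> bool" where
  "C2_on \<Omega> u \<longleftrightarrow>
     (\<forall>a\<in>\<Omega>. u differentiable (at a)) \<and>
     (\<forall>a\<in>\<Omega>. frechet_D u differentiable (at a)) \<and>
     continuous_on \<Omega> (frechet_D (frechet_D u))"

definition second_D :: "('a::real_normed_vector \<Rightarrow> real) \<Rightarrow> 'a \<Rightarrow> 'a \<Rightarrow> 'a \<Rightarrow> real" where
  "second_D u a s t = blinfun_apply (blinfun_apply (frechet_D (frechet_D u) a) s) t"

definition levi_form :: "('a::complex_hilbert_space \<Rightarrow> real) \<Rightarrow> 'a \<Rightarrow> 'a \<Rightarrow> 'a \<Rightarrow> complex" where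
  "levi_form u a s t =
     (complex_of_real (second_D u a s t)
      + complex_of_real (second_D u a (\<i> *\<^sub>C s) (\<i> *\<^sub>C t))
      + \<i> * complex_of_real (second_D u a s (\<i> *\<^sub>C t))
      - \<i> * complex_of_real (second_D u a (\<i> *\<^sub>C s) t)) / 4"

text \<open>For twice differentiable \<open>u\<close> the Levi form is a bounded sesquilinear form, so the operator
  exists (and is unique) by the Riesz representation theorem.\<close>

definition levi_operator :: "('a::complex_hilbert_space \<Rightarrow> real) \<Rightarrow> 'a \<Rightarrow> 'a \<Rightarrow> 'a" where
  "levi_operator u a =
     (THE T. bounded_clinear T \<and> (\<forall>s t. cinner (T s) t = levi_form u a s t))"

text \<open>Integral of an extended real function. It is used below only for upper semicontinuous
  functions on a circle with values below \<open>\<infinity>\<close>; these are bounded above, so the first term is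
  finite and no difference \<open>\<infinity> - \<infinity>\<close> arises.\<close>

definition ereal_integral :: "'b measure \<Rightarrow> ('b \<Rightarrow> ereal) \<Rightarrow> ereal" where
  "ereal_integral M f =
     enn2ereal (\<integral>\<^sup>+\<theta>. e2ennreal (f \<theta>) \<partial>M) - enn2ereal (\<integral>\<^sup>+\<theta>. e2ennreal (- f \<theta>) \<partial>M)"

definition usc_on :: "'a::topological_space set \<Rightarrow> ('a \<Rightarrow> ereal) \<Rightarrow> bool" where
  "usc_on \<Omega> u \<longleftrightarrow> (\<forall>z\<in>\<Omega>. Limsup (at z within \<Omega>) u \<le> u z)"

text \<open>Only the values on \<open>\<Omega>\<close> matter; \<open>\<Omega>\<close> is meant to be open.\<close>

definition PSH :: "'a::complex_hilbert_space set \<Rightarrow> ('a \<Rightarrow> ereal) set" where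
  "PSH \<Omega> = {u.
     (\<forall>z\<in>\<Omega>. u z \<noteq> \<infinity>) \<and>
     usc_on \<Omega> u \<and>
     (\<forall>C\<in>components \<Omega>. \<exists>z\<in>C. u z \<noteq> -\<infinity>) \<and>
     (\<forall>z\<in>\<Omega>. \<forall>h. (\<forall>\<zeta>. cmod \<zeta> \<le> 1 \<longrightarrow> z + \<zeta> *\<^sub>C h \<in> \<Omega>) \<longrightarrow>
        u z \<le> ereal (1 / (2 * pi)) *
                ereal_integral (lebesgue_on {0..2 * pi}) (\<lambda>\<theta>. u (z + cis \<theta> *\<^sub>C h)))}"

definition maximal_psh :: "'a::complex_hilbert_space set \<Rightarrow> ('a \<Rightarrow> ereal) \<Rightarrow> bool" where
  "maximal_psh \<Omega> u \<longleftrightarrow> u \<in> PSH \<Omega> \<and>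
     (\<forall>G v. open G \<and> bounded G \<and> closure G \<subseteq> \<Omega> \<and> v \<in> PSH G \<and>
        (\<forall>\<xi>\<in>frontier G. Limsup (at \<xi> within G) v \<le> u \<xi>) \<longrightarrow>
        (\<forall>z\<in>G. v z \<le> u z))"

end

theory Submission
  imports Defs
begin

text \<open>
  The hypothesis says that \<open>u\<close> is harmonic along every complex line in the direction \<open>x\<close>, so
  maximality reduces to the one-variable comparison principle on the slices of \<open>G\<close> by such
  lines. Fix \<open>z\<^sub>0 \<in> G\<close>. The slice \<open>K\<close> of \<open>closure G\<close> by the line through \<open>z\<^sub>0\<close> is compact even
  though \<open>closure G\<close> need not be, and the boundary of \<open>G\<close> meets the line where the hypothesis
  \<open>limsup v \<le> u\<close> applies.

  If \<open>v z\<^sub>0 > u z\<^sub>0\<close>, then for small \<open>\<epsilon> > 0\<close> the upper semicontinuous function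
  \<open>v - u + \<epsilon> \<bar>\<zeta>\<bar>\<^sup>2\<close> (extended by \<open>\<epsilon> \<bar>\<zeta>\<bar>\<^sup>2\<close> to the boundary) attains its maximum over \<open>K\<close> at a
  point \<open>p\<close> that lies in \<open>G\<close>. Near \<open>p\<close>, \<open>v\<close> is thus dominated by \<open>u\<close> plus an affine
  function minus \<open>\<epsilon>\<close> times the squared distance, with equality at \<open>p\<close>. Such a touching
  contradicts the mean value inequality for \<open>v\<close> on a small circle
  (\<open>PSH_no_strict_touching\<close>): by Taylor's formula the mean of \<open>u\<close> over the circle of radius \<open>r\<close>
  exceeds its central value by at most \<open>\<epsilon> / 2 * r\<^sup>2\<close>, because first-order terms and trace-free
  quadratic forms have mean zero. The strict gain \<open>\<epsilon> r\<^sup>2\<close> makes it enough to know \<open>u\<close> to second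
  order at one point.

  To read the hypothesis as a statement on second derivatives one needs that the operator of
  the Levi form, introduced by a definite description, exists and is unique
  (\<open>cinner_levi_operator\<close>); this rests on the Riesz representation theorem.
\<close>

section \<open>Complex Hilbert spaces\<close>

lemma scaleC_zero_left: "0 *\<^sub>C (x::'a::complex_vector) = 0"
  using scaleC_add_left[of 0 0 x] by simp

lemma scaleC_minus_left: "(- c) *\<^sub>C (x::'a::complex_vector) = - (c *\<^sub>C x)"
  using scaleC_add_left[of "-c" c x] by (simp add: scaleC_zero_left eq_neg_iff_add_eq_0)

lemma scaleC_eq_Re_Im:
  "c *\<^sub>C (x::'a::complex_vector) = Re c *\<^sub>R x + Im c *\<^sub>R (\<i> *\<^sub>C x)"
proof -
  have "c = complex_of_real (Re c) + complex_of_real (Im c) * \<i>"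
    by (simp add: complex_eq_iff)
  then have "c *\<^sub>C x = (complex_of_real (Re c) + complex_of_real (Im c) * \<i>) *\<^sub>C x"
    by simp
  then show ?thesis
    by (simp only: scaleC_add_left scaleC_scaleC[symmetric] scaleR_scaleC)
qed

lemma scaleC_scaleR: "c *\<^sub>C (r *\<^sub>R (x::'a::complex_vector)) = r *\<^sub>R (c *\<^sub>C x)"
  by (simp add: scaleR_scaleC scaleC_scaleC mult.commute)

lemma scaleC_ii: "\<i> *\<^sub>C \<i> *\<^sub>C (x::'a::complex_vector) = - x"
proof -
  have "\<i> *\<^sub>C \<i> *\<^sub>C x = complex_of_real (-1) *\<^sub>C x" by (simp add: scaleC_scaleC)
  then show ?thesis unfolding scaleR_scaleC[symmetric] by simp
qed

lemma cinner_scaleC_right: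
  "cinner x (c *\<^sub>C (y::'a::complex_hilbert_space)) = cnj c * cinner x y"
  by (metis cinner_commute cinner_scaleC_left complex_cnj_mult)

lemma norm_scaleC: "norm (c *\<^sub>C (x::'a::complex_hilbert_space)) = cmod c * norm x"
proof -
  have "(norm (c *\<^sub>C x))\<^sup>2 = Re ((c * cnj c) * cinner x x)"
    by (simp add: power2_norm_eq_inner inner_eq_Re_cinner cinner_scaleC_left
        cinner_scaleC_right algebra_simps)
  also have "\<dots> = (cmod c)\<^sup>2 * Re (cinner x x)"
    by (simp add: complex_norm_square[symmetric] del: of_real_power)
  also have "\<dots> = (cmod c * norm x)\<^sup>2"
    by (simp add: power_mult_distrib power2_norm_eq_inner inner_eq_Re_cinner)
  finally show ?thesis by (simp add: power2_eq_iff_nonneg)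
qed

lemma continuous_on_complex_line:
  "continuous_on S (\<lambda>\<zeta>. z + \<zeta> *\<^sub>C (x::'a::complex_hilbert_space))"
  by (subst scaleC_eq_Re_Im) (intro continuous_intros)

section \<open>The Riesz representation theorem and the Levi operator\<close>

text \<open>The representing vector is the minimiser of \<open>J w = \<parallel>w\<parallel>\<^sup>2 - 2 * f w\<close>. The parallelogram law
  makes every minimising sequence Cauchy, and the first variation of \<open>J\<close> at a minimiser is
  \<open>2 * (inner w t - f t)\<close>.\<close>

lemma riesz_representation:
  fixes f :: "'a::{real_inner, complete_space} \<Rightarrow> real"
  assumes "bounded_linear f"
  obtains w where "\<And>t. inner w t = f t"
proof -
  interpret f: bounded_linear f by fact
  define J where "J w = (norm w)\<^sup>2 - 2 * f w" for w
  obtain K where K: "\<And>w. norm (f w) \<le> norm w * K" using f.bounded by blast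
  have "- K\<^sup>2 \<le> J w" for w
  proof -
    have "0 \<le> (norm w - K)\<^sup>2" by simp
    then show ?thesis using K[of w] by (simp add: J_def power2_diff)
  qed
  then have bdd: "bdd_below (range J)" by (auto simp: bdd_below_def)
  define m where "m = Inf (range J)"
  have m_le: "m \<le> J w" for w unfolding m_def by (rule cINF_lower[OF bdd]) simp
  have "\<exists>w. J w < m + inverse (real (Suc n))" for n
    using cInf_lessD[of "range J" "m + inverse (real (Suc n))"] by (auto simp: m_def)
  then obtain W where W: "\<And>n. J (W n) < m + inverse (real (Suc n))" by metis
  have par: "(norm (w - w'))\<^sup>2 = 2 * J w + 2 * J w' - 4 * J ((1/2) *\<^sub>R (w + w'))" for w w'
    by (simp add: J_def f.add f.scaleR power2_norm_eq_inner inner_diff inner_add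
        inner_commute algebra_simps power_mult_distrib)
  have near: "(norm (W i - W j))\<^sup>2 \<le> 4 * inverse (real (Suc N))" if "i \<ge> N" "j \<ge> N" for i j N
  proof -
    have "inverse (real (Suc i)) \<le> inverse (real (Suc N))" "inverse (real (Suc j)) \<le> inverse (real (Suc N))"
      using that by (auto intro!: le_imp_inverse_le)
    then show ?thesis using par[of "W i" "W j"] W[of i] W[of j] m_le[of "(1/2) *\<^sub>R (W i + W j)"]
      by linarith
  qed
  have "Cauchy W"
  proof (rule CauchyI)
    fix e :: real assume "0 < e"
    then obtain N where N: "inverse (real (Suc N)) < e\<^sup>2 / 4"
      using reals_Archimedean[of "e\<^sup>2/4"] by auto
    have "norm (W i - W j) < e" if "i \<ge> N" "j \<ge> N" for i j
    proof -
      have "(norm (W i - W j))\<^sup>2 < e\<^sup>2" using near[OF that] N by linarith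
      then show ?thesis using \<open>0 < e\<close> by (meson less_imp_le power_less_imp_less_base)
    qed
    then show "\<exists>N. \<forall>i\<ge>N. \<forall>j\<ge>N. norm (W i - W j) < e" by blast
  qed
  then obtain w where w: "W \<longlonglongrightarrow> w" by (auto simp: Cauchy_convergent_iff convergent_def)
  have "(\<lambda>n. J (W n)) \<longlonglongrightarrow> J w" unfolding J_def
    by (intro tendsto_intros f.tendsto w)
  moreover have "(\<lambda>n. m + inverse (real (Suc n))) \<longlonglongrightarrow> m + 0"
    by (intro tendsto_intros LIMSEQ_inverse_real_of_nat)
  ultimately have "J w \<le> m + 0"
    by (rule LIMSEQ_le) (use W in \<open>auto intro: less_imp_le\<close>)
  then have "J w \<le> m" by simp
  have "inner w t = f t" for t
  proof (cases "t = 0")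
    case False
    define c where "c = inner w t - f t"
    \<comment> \<open>The minimum of the quadratic polynomial \<open>s \<mapsto> J (w + s *\<^sub>R t)\<close> is at this \<open>s\<close>.\<close>
    define s where "s = - c / (norm t)\<^sup>2"
    have "J w \<le> J (w + s *\<^sub>R t)" using \<open>J w \<le> m\<close> m_le order_trans by blast
    also have "J (w + s *\<^sub>R t) = J w + 2 * s * c + s\<^sup>2 * (norm t)\<^sup>2"
      by (simp add: J_def c_def f.add f.scaleR power2_norm_eq_inner inner_add inner_commute
          algebra_simps power2_eq_square[of s])
    also have "s\<^sup>2 * (norm t)\<^sup>2 = - s * c" using False by (simp add: s_def field_simps power2_eq_square)
    finally have "0 \<le> s * c" by (simp add: mult.commute)
    then have "c\<^sup>2 \<le> 0" using False by (simp add: s_def power2_eq_square divide_simps split: if_splits)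
    then show ?thesis by (simp add: c_def)
  qed (simp add: f.zero)
  then show ?thesis by (rule that)
qed

text \<open>This holds by type alone: \<open>frechet_D (frechet_D u) a\<close> is a bounded operator into bounded
  operators.\<close>

lemma second_D_bilinear: "bounded_bilinear (second_D u a)"
proof -
  interpret B: bounded_bilinear "\<lambda>s t. blinfun_apply (blinfun_apply (frechet_D (frechet_D u) a) s) t"
    by (rule bounded_bilinear.comp1[OF bounded_bilinear_blinfun_apply blinfun.bounded_linear_right])
  show ?thesis unfolding second_D_def[abs_def] by (rule B.bounded_bilinear_axioms)
qed

text \<open>Riesz representation of the real part of \<open>levi_form u a s\<close> gives the candidate \<open>T s\<close>. As the
  form is conjugate linear in its second argument, its imaginary part at \<open>t\<close> is its real part at
  \<open>\<i> *\<^sub>C t\<close>, so \<open>T s\<close> represents the whole form. Linearity of \<open>T\<close> and uniqueness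
  follow because a vector is determined by its inner products.\<close>

lemma cinner_levi_operator:
  fixes u :: "'a::complex_hilbert_space \<Rightarrow> real"
  shows "cinner (levi_operator u a s) t = levi_form u a s t"
proof -
  interpret D: bounded_bilinear "second_D u a" by (rule second_D_bilinear)
  let ?B = "levi_form u a"
  have Re_B: "Re (?B s t) = (second_D u a s t + second_D u a (\<i> *\<^sub>C s) (\<i> *\<^sub>C t)) / 4" for s t
    by (simp add: levi_form_def)
  have Im_B: "Im (?B s t) = Re (?B s (\<i> *\<^sub>C t))" for s t
    by (simp add: levi_form_def scaleC_ii D.minus_right)
  have B_add: "?B (s + s') t = ?B s t + ?B s' t" for s s' t
    by (simp add: levi_form_def scaleC_add_right D.add_left algebra_simps add_divide_distrib diff_divide_distrib)
  have B_scaleC: "?B (c *\<^sub>C s) t = c * ?B s t" for c s t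
    by (subst scaleC_eq_Re_Im)
      (simp add: levi_form_def scaleC_add_right scaleC_scaleR scaleC_ii D.add_left D.scaleR_left
        D.minus_left D.diff_left complex_eq_iff, simp add: algebra_simps)
  obtain K where "0 \<le> K" and K: "\<And>s t. norm (second_D u a s t) \<le> norm s * norm t * K"
    using D.nonneg_bounded by blast
  have Re_B_le: "\<bar>Re (?B s t)\<bar> \<le> K / 2 * norm s * norm t" for s t
    using K[of s t] K[of "\<i> *\<^sub>C s" "\<i> *\<^sub>C t"] by (simp add: Re_B norm_scaleC algebra_simps)
  have "bounded_linear (\<lambda>t. Re (?B s t))" for s
    unfolding Re_B
    by (rule bounded_linear_intro[where K="K / 2 * norm s"])
      (use Re_B_le[of s] in \<open>auto simp: Re_B D.add_right D.scaleR_right scaleC_add_right scaleC_scaleR algebra_simps add_divide_distrib\<close>)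
  then have "\<exists>w. \<forall>t. inner w t = Re (?B s t)" for s
    by (metis riesz_representation)
  then obtain T where T: "\<And>s t. inner (T s) t = Re (?B s t)" by metis
  have T_eq: "cinner (T s) t = ?B s t" for s t
  proof (rule complex_eqI)
    show "Re (cinner (T s) t) = Re (?B s t)" using T by (simp add: inner_eq_Re_cinner)
    have "Im (cinner (T s) t) = Re (cinner (T s) (\<i> *\<^sub>C t))" by (simp add: cinner_scaleC_right)
    then show "Im (cinner (T s) t) = Im (?B s t)" using T by (simp add: inner_eq_Re_cinner Im_B)
  qed
  have ext: "w = w'" if "\<And>t. cinner w t = cinner w' t" for w w' :: 'a
    by (metis inner_eq_Re_cinner that vector_eq_rdot)
  have T_add: "T (s + s') = T s + T s'" for s s'
    by (rule ext) (simp add: T_eq B_add cinner_add_left)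
  have T_scaleC: "T (c *\<^sub>C s) = c *\<^sub>C T s" for c s
    by (rule ext) (simp add: T_eq B_scaleC cinner_scaleC_left)
  have "norm (T s) \<le> norm s * (K / 2)" for s
  proof (cases "T s = 0")
    case False
    have "norm (T s) * norm (T s) \<le> (K / 2 * norm s) * norm (T s)"
      using T[of s "T s"] Re_B_le[of s "T s"] by (simp add: power2_norm_eq_inner[symmetric] power2_eq_square)
    with False show ?thesis by (simp add: mult.commute)
  qed (simp add: \<open>0 \<le> K\<close>)
  then have "bounded_linear T"
    by (intro bounded_linear_intro[where K="K / 2"] T_add) (auto simp: scaleR_scaleC T_scaleC)
  then have "bounded_clinear T" by (simp add: bounded_clinear_def T_scaleC)
  then have "\<exists>!T. bounded_clinear T \<and> (\<forall>s t. cinner (T s) t = ?B s t)"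
    using T_eq by (intro ex1I[of _ T]) (auto intro!: ext)
  from theI'[OF this] show ?thesis unfolding levi_operator_def by blast
qed

section \<open>Upper semicontinuous functions\<close>

text \<open>The limes superior in \<open>usc_on\<close> is over punctured neighbourhoods; the strict sublevel sets
  include the centre, which makes composition and compactness arguments immediate.\<close>

lemma usc_on_iff_openin:
  "usc_on S f \<longleftrightarrow> (\<forall>c. openin (top_of_set S) {z \<in> S. f z < c})"
proof
  assume f: "usc_on S f"
  show "\<forall>c. openin (top_of_set S) {z \<in> S. f z < c}"
  proof
    fix c
    show "openin (top_of_set S) {z \<in> S. f z < c}"
    proof (subst openin_subopen, intro ballI)
      fix z assume z: "z \<in> {z \<in> S. f z < c}"
      then have "\<forall>\<^sub>F y in at z within S. f y < c"
        using f by (auto simp: usc_on_def Limsup_le_iff)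
      then obtain U where "open U" "z \<in> U" "\<forall>y\<in>U. y \<noteq> z \<longrightarrow> y \<in> S \<longrightarrow> f y < c"
        by (auto simp: eventually_at_topological)
      then show "\<exists>T. openin (top_of_set S) T \<and> z \<in> T \<and> T \<subseteq> {z \<in> S. f z < c}"
        using z by (intro exI[of _ "S \<inter> U"]) auto
    qed
  qed
next
  assume op: "\<forall>c. openin (top_of_set S) {z \<in> S. f z < c}"
  show "usc_on S f"
    unfolding usc_on_def Limsup_le_iff
  proof (intro ballI allI impI)
    fix z c assume z: "z \<in> S" "f z < c"
    obtain U where "open U" "{z \<in> S. f z < c} = S \<inter> U"
      using op by (meson openin_open)
    then show "\<forall>\<^sub>F y in at z within S. f y < c"
      using z unfolding eventually_at_topological by (intro exI[of _ U]) auto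
  qed
qed

lemma usc_on_compose:
  assumes "usc_on S f" "continuous_on T g" "g \<in> T \<rightarrow> S"
  shows "usc_on T (\<lambda>x. f (g x))"
  unfolding usc_on_iff_openin
proof
  fix c
  have "{x \<in> T. f (g x) < c} = T \<inter> g -` {z \<in> S. f z < c}" using assms(3) by auto
  also have "openin (top_of_set T) \<dots>"
    using assms by (intro continuous_openin_preimage) (auto simp: usc_on_iff_openin)
  finally show "openin (top_of_set T) {x \<in> T. f (g x) < c}" .
qed

lemma usc_on_add_continuous:
  assumes f: "usc_on S f" and q: "continuous_on S q"
  shows "usc_on S (\<lambda>z. f z + ereal (q z))"
  unfolding usc_on_iff_openin
proof
  fix c
  \<comment> \<open>A real separating level avoids all arithmetic with \<open>-\<infinity>\<close>, and makes the sublevel set of the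
    sum a union of intersections of sublevel sets.\<close>
  have split: "f z + ereal (q z) < c \<longleftrightarrow> (\<exists>d. f z < ereal d \<and> ereal (q z + d) < c)" for z
  proof
    assume *: "f z + ereal (q z) < c"
    have "f z < c - ereal (q z)" using * by (cases "f z"; cases c) auto
    then obtain d where "f z < ereal d" "ereal d < c - ereal (q z)"
      using ereal_dense2 by blast
    then show "\<exists>d. f z < ereal d \<and> ereal (q z + d) < c" by (intro exI[of _ d]; cases c) auto
  next
    assume "\<exists>d. f z < ereal d \<and> ereal (q z + d) < c"
    then show "f z + ereal (q z) < c" by (cases "f z"; cases c) auto
  qed
  have "continuous_on S (\<lambda>z. ereal (q z + d))" for d
    by (intro continuous_intros q)
  then have "openin (top_of_set S) (S \<inter> (\<lambda>z. ereal (q z + d)) -` {..<c})" for d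
    by (rule continuous_openin_preimage_gen) simp
  then have "openin (top_of_set S)
      (\<Union>d. {z \<in> S. f z < ereal d} \<inter> (S \<inter> (\<lambda>z. ereal (q z + d)) -` {..<c}))"
    using f by (intro openin_Union) (auto simp: usc_on_iff_openin)
  also have "(\<Union>d. {z \<in> S. f z < ereal d} \<inter> (S \<inter> (\<lambda>z. ereal (q z + d)) -` {..<c}))
      = {z \<in> S. f z + ereal (q z) < c}"
    by (auto simp: split)
  finally show "openin (top_of_set S) {z \<in> S. f z + ereal (q z) < c}" .
qed

text \<open>If no maximum existed, the sets \<open>{y. f y < f q}\<close> for \<open>q \<in> K\<close> would cover \<open>K\<close>; in a finite
  subcover the point \<open>q\<close> with the largest value is not covered.\<close>

lemma usc_on_attains_max:
  assumes f: "usc_on K f" and K: "compact K" "K \<noteq> {}"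
  obtains p where "p \<in> K" "\<And>q. q \<in> K \<Longrightarrow> f q \<le> f p"
proof -
  have "\<exists>p\<in>K. \<forall>q\<in>K. f q \<le> f p"
  proof (rule ccontr)
    assume no_max: "\<not> ?thesis"
    define \<U> where "\<U> = (\<lambda>q. {y \<in> K. f y < f q}) ` K"
    have "K \<subseteq> \<Union>\<U>" using no_max by (auto simp: \<U>_def not_le)
    moreover have "\<forall>C\<in>\<U>. openin (top_of_set K) C"
      using f by (auto simp: \<U>_def usc_on_iff_openin)
    ultimately have "\<exists>Q\<subseteq>\<U>. finite Q \<and> K \<subseteq> \<Union>Q"
      using K(1)[unfolded compact_eq_openin_cover, rule_format, of \<U>] by simp
    then obtain Q where Q: "Q \<subseteq> (\<lambda>q. {y \<in> K. f y < f q}) ` K" "finite Q" "K \<subseteq> \<Union>Q"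
      unfolding \<U>_def by auto
    then obtain P where P: "P \<subseteq> K" "finite P" "Q = (\<lambda>q. {y \<in> K. f y < f q}) ` P"
      using finite_subset_image[OF Q(2,1)] by blast
    have "P \<noteq> {}" using Q(3) K(2) unfolding P(3) by blast
    then have "Max (f ` P) \<in> f ` P" using P(2) by (intro Max_in) auto
    then obtain q where q: "q \<in> P" "Max (f ` P) = f q" by (rule imageE)
    then have "q \<in> \<Union>Q" using Q(3) P(1) by (meson subsetD)
    then obtain q' where q': "q' \<in> P" "f q < f q'" unfolding P(3) by blast
    have "f q' \<le> Max (f ` P)" using P(2) q'(1) by (intro Max_ge) auto
    then show False using q(2) q'(2) by (simp add: not_less[symmetric])
  qed
  then show ?thesis using that by blast
qed

text \<open>The boundary condition in the definition of maximality says precisely that \<open>v\<close>, continued by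
  \<open>u\<close>, is upper semicontinuous up to the boundary. This is what allows a maximum over a compact
  slice of the closure.\<close>

lemma usc_on_boundary_extension:
  assumes G: "open G" and v: "usc_on G v"
    and u: "continuous_on (closure G) u"
    and bd: "\<And>\<xi>. \<xi> \<in> frontier G \<Longrightarrow> Limsup (at \<xi> within G) v \<le> ereal (u \<xi>)"
  shows "usc_on (closure G) (\<lambda>z. if z \<in> G then v z else ereal (u z))"
  unfolding usc_on_def Limsup_le_iff
proof (intro ballI allI impI)
  fix z c
  assume z: "z \<in> closure G" and c: "(if z \<in> G then v z else ereal (u z)) < c"
  have "Limsup (at z within G) v \<le> (if z \<in> G then v z else ereal (u z))"
    using v bd z G by (auto simp: usc_on_def frontier_def interior_open)
  then have "\<forall>\<^sub>F y in at z within G. v y < c"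
    using c unfolding Limsup_le_iff by blast
  then have 1: "\<forall>\<^sub>F y in at z within closure G. y \<in> G \<longrightarrow> v y < c"
    unfolding eventually_at_topological by blast
  have 2: "\<forall>\<^sub>F y in at z within closure G. y \<notin> G \<longrightarrow> ereal (u y) < c"
  proof (cases "z \<in> G")
    case True
    then show ?thesis unfolding eventually_at_topological using G by blast
  next
    case False
    have "((\<lambda>y. ereal (u y)) \<longlongrightarrow> ereal (u z)) (at z within closure G)"
      using u z by (auto simp: continuous_on_def)
    then have "\<forall>\<^sub>F y in at z within closure G. ereal (u y) < c"
      using c False by (intro order_tendstoD(2)) auto
    then show ?thesis by (rule eventually_mono) simp
  qed
  show "\<forall>\<^sub>F y in at z within closure G. (if y \<in> G then v y else ereal (u y)) < c"
    using 1 2 by eventually_elim auto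
qed

section \<open>The mean value inequality and second-order contact\<close>

text \<open>The two nonnegative integrals are monotone for arbitrary integrands, so a pointwise
  majorant on the circle suffices to estimate the mean of a plurisubharmonic function.\<close>

lemma ereal_integral_le_lebesgue_integral:
  assumes g: "integrable M g" and le: "\<And>t. t \<in> space M \<Longrightarrow> f t \<le> ereal (g t)"
  shows "ereal_integral M f \<le> ereal (integral\<^sup>L M g)"
proof -
  obtain p where p: "0 \<le> p" "(\<integral>\<^sup>+ t. ennreal (g t) \<partial>M) = ennreal p"
    using g by (auto simp: real_integrable_def less_top elim!: ennreal_cases)
  obtain n where n: "0 \<le> n" "(\<integral>\<^sup>+ t. ennreal (- g t) \<partial>M) = ennreal n"
    using g by (auto simp: real_integrable_def less_top elim!: ennreal_cases)
  have "ereal_integral M f \<le>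
      enn2ereal (\<integral>\<^sup>+ t. ennreal (g t) \<partial>M) - enn2ereal (\<integral>\<^sup>+ t. ennreal (- g t) \<partial>M)"
    unfolding ereal_integral_def
  proof (intro ereal_minus_mono)
    show "enn2ereal (\<integral>\<^sup>+ t. e2ennreal (f t) \<partial>M) \<le> enn2ereal (\<integral>\<^sup>+ t. ennreal (g t) \<partial>M)"
      using le by (auto simp flip: less_eq_ennreal.rep_eq e2ennreal_ereal intro!: nn_integral_mono e2ennreal_mono)
    have "ereal (- g t) \<le> - f t" if "t \<in> space M" for t
      using le[OF that] by (cases "f t") auto
    then show "enn2ereal (\<integral>\<^sup>+ t. ennreal (- g t) \<partial>M) \<le> enn2ereal (\<integral>\<^sup>+ t. e2ennreal (- f t) \<partial>M)"
      by (auto simp flip: less_eq_ennreal.rep_eq e2ennreal_ereal intro!: nn_integral_mono e2ennreal_mono)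
  qed
  also have "\<dots> = ereal (integral\<^sup>L M g)"
    using p n by (simp add: real_lebesgue_integral_def[OF g])
  finally show ?thesis .
qed

text \<open>The trigonometric polynomial is the restriction to the unit circle of a constant plus a linear
  form plus a trace-free quadratic form in \<open>(cos t, sin t)\<close>, and its mean is the
  constant.\<close>

lemma PSH_le_constant_term:
  assumes v: "v \<in> PSH G" and z: "z \<in> G"
    and disc: "\<And>\<zeta>. cmod \<zeta> \<le> 1 \<Longrightarrow> z + \<zeta> *\<^sub>C h \<in> G"
    and le: "\<And>t. v (z + cis t *\<^sub>C h) \<le> ereal (A + B * cos t + C * sin t
        + E * ((cos t)\<^sup>2 - (sin t)\<^sup>2) + F * (cos t * sin t))"
  shows "v z \<le> ereal A"
proof -
  let ?g = "\<lambda>t::real. A + B * cos t + C * sin t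
        + E * ((cos t)\<^sup>2 - (sin t)\<^sup>2) + F * (cos t * sin t)"
  let ?P = "\<lambda>t::real. A * t + B * sin t - C * cos t + E * (sin t * cos t) + F / 2 * (sin t)\<^sup>2"
  let ?M = "lebesgue_on {0..2 * pi}"
  have int: "integrable ?M ?g"
    by (rule continuous_imp_integrable_real) (intro continuous_intros)
  have "(?g has_integral (?P (2 * pi) - ?P 0)) {0..2 * pi}"
    by (rule fundamental_theorem_of_calculus)
      (auto intro!: derivative_eq_intros simp: power2_eq_square algebra_simps
        simp flip: has_real_derivative_iff_has_vector_derivative)
  then have "integral\<^sup>L ?M ?g = 2 * pi * A"
    by (subst lebesgue_integral_eq_integral[OF int]) (auto simp: integral_unique)
  then have "ereal_integral ?M (\<lambda>t. v (z + cis t *\<^sub>C h)) \<le> ereal (2 * pi * A)"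
    using ereal_integral_le_lebesgue_integral[OF int, of "\<lambda>t. v (z + cis t *\<^sub>C h)"] le by auto
  then have "ereal (1 / (2 * pi)) * ereal_integral ?M (\<lambda>t. v (z + cis t *\<^sub>C h))
      \<le> ereal (1 / (2 * pi)) * ereal (2 * pi * A)"
    by (intro ereal_mult_left_mono) auto
  moreover have "v z \<le> ereal (1 / (2 * pi)) * ereal_integral ?M (\<lambda>t. v (z + cis t *\<^sub>C h))"
    using v z disc by (auto simp: PSH_def)
  ultimately show ?thesis by simp
qed

text \<open>Peano's form of the remainder. The mean value theorem is applied on the segment from \<open>a\<close>
  to \<open>a + h\<close> to the difference of \<open>u\<close> and its Taylor polynomial, whose derivative is bounded by
  the first-order expansion of \<open>frechet_D u\<close> at \<open>a\<close>.\<close>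

lemma second_order_taylor:
  fixes u :: "'a::real_normed_vector \<Rightarrow> real"
  assumes S: "open S" "a \<in> S" and u: "\<And>y. y \<in> S \<Longrightarrow> u differentiable (at y)"
    and Du: "frechet_D u differentiable (at a)" and "0 < e"
  obtains d where "0 < d" "\<And>h. norm h < d \<Longrightarrow>
    \<bar>u (a + h) - u a - blinfun_apply (frechet_D u a) h - second_D u a h h / 2\<bar> \<le> e * (norm h)\<^sup>2"
proof -
  interpret D: bounded_bilinear "second_D u a" by (rule second_D_bilinear)
  have D2: "(frechet_D u has_derivative blinfun_apply (frechet_D (frechet_D u) a)) (at a)"
    using Du unfolding frechet_D_def[of "frechet_D u"]
    by (subst bounded_linear_Blinfun_apply)
      (auto simp: frechet_derivative_works intro: has_derivative_bounded_linear)
  have D1: "(u has_derivative blinfun_apply (frechet_D u y)) (at y)" if "y \<in> S" for y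
    using u[OF that] unfolding frechet_D_def
    by (subst bounded_linear_Blinfun_apply)
      (auto simp: frechet_derivative_works intro: has_derivative_bounded_linear)
  obtain d1 where d1: "0 < d1" "\<And>y. norm (y - a) < d1 \<Longrightarrow>
      norm (frechet_D u y - frechet_D u a - blinfun_apply (frechet_D (frechet_D u) a) (y - a))
        \<le> e * norm (y - a)"
    using D2 \<open>0 < e\<close> unfolding has_derivative_at_alt by blast
  obtain d2 where d2: "0 < d2" "ball a d2 \<subseteq> S" using S by (auto simp: open_contains_ball)
  show ?thesis
  proof (rule that[of "min d1 d2"])
    fix h :: 'a assume h: "norm h < min d1 d2"
    define g where "g t = u (a + t *\<^sub>R h) - t * blinfun_apply (frechet_D u a) h
        - t\<^sup>2 / 2 * second_D u a h h" for t
    define g' where "g' t = blinfun_apply (frechet_D u (a + t *\<^sub>R h) - frechet_D u a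
        - blinfun_apply (frechet_D (frechet_D u) a) (t *\<^sub>R h)) h" for t
    have small: "norm (t *\<^sub>R h) < min d1 d2" if "0 \<le> t" "t \<le> 1" for t
      using that h mult_left_le_one_le[of "norm h" t] by simp
    have "(g has_real_derivative g' t) (at t)" if t: "0 \<le> t" "t \<le> 1" for t
    proof -
      have "a + t *\<^sub>R h \<in> S" using small[OF t] d2 by (auto simp: dist_norm subset_iff)
      have "((\<lambda>t. a + t *\<^sub>R h) has_derivative (\<lambda>s. s *\<^sub>R h)) (at t)"
        by (auto intro!: derivative_eq_intros)
      from has_derivative_compose[OF this D1[OF \<open>a + t *\<^sub>R h \<in> S\<close>]]
      have "((\<lambda>t. u (a + t *\<^sub>R h)) has_real_derivative
          blinfun_apply (frechet_D u (a + t *\<^sub>R h)) h) (at t)"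
        by (simp add: has_field_derivative_def blinfun.scaleR_right mult.commute[of _ "blinfun_apply _ _"])
      then show ?thesis unfolding g_def g'_def
        by (auto intro!: derivative_eq_intros simp: blinfun.diff_left blinfun.scaleR_left
            blinfun.scaleR_right second_D_def)
    qed
    then obtain t where t: "0 < t" "t < 1" "g 1 - g 0 = (1 - 0) * g' t"
      using MVT2[of 0 1 g g'] by auto
    have "\<bar>g' t\<bar> \<le> (e * norm (t *\<^sub>R h)) * norm h"
      unfolding g'_def real_norm_def[symmetric]
      by (rule order_trans[OF norm_blinfun mult_right_mono])
        (use d1(2)[of "a + t *\<^sub>R h"] small[of t] t in auto)
    also have "\<dots> \<le> e * (norm h)\<^sup>2"
      using t \<open>0 < e\<close> mult_left_le_one_le[of "e * (norm h)\<^sup>2" t]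
      by (simp add: power2_eq_square mult_ac)
    finally show "\<bar>u (a + h) - u a - blinfun_apply (frechet_D u a) h - second_D u a h h / 2\<bar>
        \<le> e * (norm h)\<^sup>2"
      using t by (simp add: g_def)
  qed (use d1 d2 in auto)
qed

text \<open>
  Along the complex line, \<open>v\<close> would be dominated by a function whose circular means are at most
  \<open>\<beta> - \<epsilon> / 2 * r\<^sup>2\<close>: of the strict gain \<open>\<epsilon> r\<^sup>2\<close>, half is spent on the Taylor remainder of \<open>u\<close>, and
  the hypothesis \<open>harm\<close> removes the mean of the quadratic term. The linear term \<open>B, C\<close> has mean
  zero; it accommodates touching parabolas that are not centred at \<open>z\<close>.
\<close>

lemma PSH_no_strict_touching:
  fixes u :: "'a::complex_hilbert_space \<Rightarrow> real"
  assumes v: "v \<in> PSH G" and G: "open G" and z: "z \<in> G" "v z = ereal \<beta>"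
    and \<Omega>: "open \<Omega>" "z \<in> \<Omega>" and u: "\<And>y. y \<in> \<Omega> \<Longrightarrow> u differentiable (at y)"
    and Du: "frechet_D u differentiable (at z)"
    and x: "norm x = 1"
    and harm: "second_D u z x x + second_D u z (\<i> *\<^sub>C x) (\<i> *\<^sub>C x) = 0"
    and \<epsilon>: "0 < \<epsilon>"
    and touch: "\<And>\<zeta>. z + \<zeta> *\<^sub>C x \<in> G \<Longrightarrow> v (z + \<zeta> *\<^sub>C x) \<le>
      ereal (\<beta> + (u (z + \<zeta> *\<^sub>C x) - u z) + B * Re \<zeta> + C * Im \<zeta> - \<epsilon> * (cmod \<zeta>)\<^sup>2)"
  shows False
proof -
  obtain d where d: "0 < d" "\<And>h. norm h < d \<Longrightarrow>
    \<bar>u (z + h) - u z - blinfun_apply (frechet_D u z) h - second_D u z h h / 2\<bar>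
      \<le> \<epsilon> / 2 * (norm h)\<^sup>2"
    using second_order_taylor[OF \<Omega> u Du, of "\<epsilon> / 2"] \<epsilon> by auto
  obtain d' where d': "0 < d'" "ball z d' \<subseteq> G"
    using z(1) G by (auto simp: open_contains_ball)
  define r where "r = min d d' / 2"
  have r: "0 < r" "r < d" "r < d'" using d(1) d'(1) by (auto simp: r_def)
  have disc: "z + \<zeta> *\<^sub>C (r *\<^sub>R x) \<in> G" if "cmod \<zeta> \<le> 1" for \<zeta>
  proof -
    have "cmod \<zeta> * r \<le> r" using that r(1) by (intro mult_left_le_one_le) auto
    also note r(3)
    finally have "z + \<zeta> *\<^sub>C (r *\<^sub>R x) \<in> ball z d'"
      using r(1) x by (simp add: dist_norm norm_scaleC)
    then show ?thesis using d'(2) by blast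
  qed
  interpret D: bounded_bilinear "second_D u z" by (rule second_D_bilinear)
  let ?D = "\<lambda>h. blinfun_apply (frechet_D u z) h" and ?Q = "second_D u z"
  have harm': "?Q (\<i> *\<^sub>C x) (\<i> *\<^sub>C x) = - ?Q x x" using harm by simp
  have "v (z + cis t *\<^sub>C (r *\<^sub>R x)) \<le> ereal ((\<beta> - \<epsilon> / 2 * r\<^sup>2)
      + (r * (?D x + B)) * cos t + (r * (?D (\<i> *\<^sub>C x) + C)) * sin t
      + (r\<^sup>2 / 2 * ?Q x x) * ((cos t)\<^sup>2 - (sin t)\<^sup>2)
      + (r\<^sup>2 / 2 * (?Q x (\<i> *\<^sub>C x) + ?Q (\<i> *\<^sub>C x) x)) * (cos t * sin t))"
    (is "_ \<le> ereal ?rhs") for t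
  proof -
    define \<zeta> where "\<zeta> = complex_of_real r * cis t"
    define h where "h = \<zeta> *\<^sub>C x"
    have h_circle: "cis t *\<^sub>C (r *\<^sub>R x) = h"
      by (simp add: h_def \<zeta>_def scaleR_scaleC scaleC_scaleC mult.commute)
    have h_eq: "h = r *\<^sub>R (cos t *\<^sub>R x + sin t *\<^sub>R (\<i> *\<^sub>C x))"
      unfolding h_circle[symmetric]
      by (simp add: scaleC_scaleR scaleC_eq_Re_Im[of "cis t"])
    have \<zeta>_norm: "cmod \<zeta> = r" using r by (simp add: \<zeta>_def norm_mult)
    then have h_norm: "norm h = r" using x by (simp add: h_def norm_scaleC)
    have "z + h \<in> G" using disc[of "cis t"] by (simp add: h_circle)
    then have "v (z + h) \<le> ereal (\<beta> + (u (z + h) - u z) + B * Re \<zeta> + C * Im \<zeta> - \<epsilon> * r\<^sup>2)"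
      using touch[of \<zeta>] by (simp add: h_def \<zeta>_norm)
    also have "\<beta> + (u (z + h) - u z) + B * Re \<zeta> + C * Im \<zeta> - \<epsilon> * r\<^sup>2 \<le> ?rhs"
    proof -
      have 1: "u (z + h) \<le> u z + ?D h + ?Q h h / 2 + \<epsilon> / 2 * r\<^sup>2"
        using d(2)[of h] r(2) unfolding h_norm by linarith
      have 2: "?D h = r * (cos t * ?D x + sin t * ?D (\<i> *\<^sub>C x))"
        by (simp add: h_eq blinfun.add_right blinfun.scaleR_right)
      have 3: "?Q h h = r\<^sup>2 * (((cos t)\<^sup>2 - (sin t)\<^sup>2) * ?Q x x
          + (cos t * sin t) * (?Q x (\<i> *\<^sub>C x) + ?Q (\<i> *\<^sub>C x) x))"
        by (simp add: h_eq D.add_left D.add_right D.scaleR_left D.scaleR_right harm'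
            power2_eq_square algebra_simps)
      have 4: "Re \<zeta> = r * cos t" "Im \<zeta> = r * sin t" by (simp_all add: \<zeta>_def)
      show ?thesis using 1 unfolding 2 3 4
        by (simp add: algebra_simps add_divide_distrib diff_divide_distrib)
    qed
    finally show ?thesis by (simp add: h_circle)
  qed
  from PSH_le_constant_term[OF v z(1) disc this] have "\<beta> \<le> \<beta> - \<epsilon> / 2 * r\<^sup>2" by (simp add: z)
  then show False using \<epsilon> r(1) by (simp add: mult_le_0_iff)
qed

section \<open>Maximality\<close>

theorem corollary4p5:
  fixes \<Omega> :: "'a::complex_hilbert_space set"
    and u :: "'a \<Rightarrow> real"
    and x :: 'a
  assumes "open \<Omega>"
    and "(\<lambda>z. ereal (u z)) \<in> PSH \<Omega>"
    and "C2_on \<Omega> u"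
    and "norm x = 1"
    and "\<forall>a\<in>\<Omega>. cinner (levi_operator u a x) x = 0"
  shows "maximal_psh \<Omega> (\<lambda>z. ereal (u z))"
  unfolding maximal_psh_def
proof (intro conjI allI impI ballI)
  show "(\<lambda>z. ereal (u z)) \<in> PSH \<Omega>" by fact
next
  fix G v z\<^sub>0
  assume "open G \<and> bounded G \<and> closure G \<subseteq> \<Omega> \<and> v \<in> PSH G \<and>
    (\<forall>\<xi>\<in>frontier G. Limsup (at \<xi> within G) v \<le> ereal (u \<xi>))" and z\<^sub>0: "z\<^sub>0 \<in> G"
  then have G: "open G" "bounded G" "closure G \<subseteq> \<Omega>" and v: "v \<in> PSH G"
    and bd: "\<And>\<xi>. \<xi> \<in> frontier G \<Longrightarrow> Limsup (at \<xi> within G) v \<le> ereal (u \<xi>)" by auto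
  have G_cl: "G \<subseteq> closure G" by (rule closure_subset)
  have diff: "u differentiable (at a)" "frechet_D u differentiable (at a)" if "a \<in> \<Omega>" for a
    using \<open>C2_on \<Omega> u\<close> that by (auto simp: C2_on_def)
  have u_cont: "continuous_on (closure G) u"
    using diff(1) G(3) by (meson continuous_at_imp_continuous_on differentiable_imp_continuous_within subsetD)
  show "v z\<^sub>0 \<le> ereal (u z\<^sub>0)"
  proof (rule ccontr)
    assume "\<not> v z\<^sub>0 \<le> ereal (u z\<^sub>0)"
    moreover have v_top: "v z \<noteq> \<infinity>" if "z \<in> G" for z using v that by (auto simp: PSH_def)
    ultimately obtain b where b: "v z\<^sub>0 = ereal b" "u z\<^sub>0 < b"
      using z\<^sub>0 by (cases "v z\<^sub>0") auto
    define L where "L \<zeta> = z\<^sub>0 + \<zeta> *\<^sub>C x" for \<zeta>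
    have L_cont: "continuous_on S L" for S
      unfolding L_def by (rule continuous_on_complex_line)
    have L_add: "L (p + \<zeta>) = L p + \<zeta> *\<^sub>C x" for p \<zeta>
      by (simp add: L_def scaleC_add_left)
    have L_0: "L 0 = z\<^sub>0" by (simp add: L_def scaleC_zero_left)
    define K where "K = L -` closure G"
    obtain R where R: "0 < R" "\<And>z. z \<in> closure G \<Longrightarrow> norm (z - z\<^sub>0) \<le> R"
    proof -
      have "bounded ((\<lambda>z. z - z\<^sub>0) ` closure G)"
        using G(2) by (intro bounded_translation_minus bounded_closure)
      then show ?thesis using that by (auto simp: bounded_pos)
    qed
    have K_R: "cmod \<zeta> \<le> R" if "\<zeta> \<in> K" for \<zeta>
      using R(2)[of "L \<zeta>"] that \<open>norm x = 1\<close> by (simp add: K_def L_def norm_scaleC)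
    have "closed K" unfolding K_def using L_cont by (intro closed_vimage) auto
    moreover have "bounded K" using K_R by (auto simp: bounded_iff)
    ultimately have K: "compact K" by (simp add: compact_eq_bounded_closed)
    have "0 \<in> K" using z\<^sub>0 G_cl by (auto simp: K_def L_0)
    \<comment> \<open>Small enough that the perturbation cannot lift the boundary values, at most \<open>\<epsilon> * R\<^sup>2\<close>, to the
      value \<open>b - u z\<^sub>0\<close> at the centre.\<close>
    define \<epsilon> where "\<epsilon> = (b - u z\<^sub>0) / (2 * R\<^sup>2)"
    have \<epsilon>: "0 < \<epsilon>" "\<epsilon> * R\<^sup>2 < b - u z\<^sub>0" using R(1) b(2) by (auto simp: \<epsilon>_def field_simps)
    define w where "w z = (if z \<in> G then v z else ereal (u z))" for z
    define \<Phi> where "\<Phi> \<zeta> = w (L \<zeta>) + ereal (\<epsilon> * (cmod \<zeta>)\<^sup>2 - u (L \<zeta>))" for \<zeta>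
    have "usc_on (closure G) w"
      unfolding w_def using v by (intro usc_on_boundary_extension G u_cont bd) (auto simp: PSH_def)
    then have "usc_on K \<Phi>" unfolding \<Phi>_def
      by (intro usc_on_add_continuous usc_on_compose[of _ w _ L] continuous_intros
          continuous_on_compose2[OF u_cont] L_cont) (auto simp: K_def)
    then obtain p where p: "p \<in> K" and p_max: "\<And>\<zeta>. \<zeta> \<in> K \<Longrightarrow> \<Phi> \<zeta> \<le> \<Phi> p"
      using usc_on_attains_max K \<open>0 \<in> K\<close> by (metis empty_iff)
    have \<Phi>_0: "\<Phi> 0 = ereal (b - u z\<^sub>0)" using z\<^sub>0 by (simp add: \<Phi>_def w_def L_0 b)
    have Lp: "L p \<in> G"
    proof (rule ccontr)
      assume "L p \<notin> G"
      then have "\<Phi> p = ereal (\<epsilon> * (cmod p)\<^sup>2)" by (simp add: \<Phi>_def w_def)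
      moreover have "\<epsilon> * (cmod p)\<^sup>2 \<le> \<epsilon> * R\<^sup>2" using K_R[OF p] \<epsilon>(1) by (intro mult_left_mono power_mono) auto
      ultimately show False using p_max[OF \<open>0 \<in> K\<close>] \<Phi>_0 \<epsilon>(2) by simp
    qed
    then obtain \<beta> where \<beta>: "v (L p) = ereal \<beta>"
      using v_top p_max[OF \<open>0 \<in> K\<close>] by (cases "v (L p)") (auto simp: \<Phi>_0 \<Phi>_def w_def L_0 z\<^sub>0 b)
    have v_le: "v (L \<zeta>) \<le> ereal (\<beta> + \<epsilon> * (cmod p)\<^sup>2 - u (L p) + u (L \<zeta>) - \<epsilon> * (cmod \<zeta>)\<^sup>2)"
      if "L \<zeta> \<in> G" for \<zeta>
    proof -
      have "\<zeta> \<in> K" using that G_cl by (auto simp: K_def)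
      from p_max[OF this] have "v (L \<zeta>) + ereal (\<epsilon> * (cmod \<zeta>)\<^sup>2 - u (L \<zeta>))
          \<le> ereal (\<beta> + (\<epsilon> * (cmod p)\<^sup>2 - u (L p)))"
        by (simp add: \<Phi>_def w_def that Lp \<beta>)
      then show ?thesis by (cases "v (L \<zeta>)") auto
    qed
    have Lp_\<Omega>: "L p \<in> \<Omega>" using p G(3) by (auto simp: K_def)
    have "Re (cinner (levi_operator u (L p) x) x) = 0" using assms(5) Lp_\<Omega> by simp
    then have harm: "second_D u (L p) x x + second_D u (L p) (\<i> *\<^sub>C x) (\<i> *\<^sub>C x) = 0"
      by (simp add: cinner_levi_operator levi_form_def)
    have touch: "v (L p + \<zeta> *\<^sub>C x) \<le> ereal (\<beta> + (u (L p + \<zeta> *\<^sub>C x) - u (L p))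
        + (- 2 * \<epsilon> * Re p) * Re \<zeta> + (- 2 * \<epsilon> * Im p) * Im \<zeta> - \<epsilon> * (cmod \<zeta>)\<^sup>2)"
      if "L p + \<zeta> *\<^sub>C x \<in> G" for \<zeta>
    proof -
      have "(cmod (p + \<zeta>))\<^sup>2 = (cmod p)\<^sup>2 + 2 * (Re p * Re \<zeta> + Im p * Im \<zeta>) + (cmod \<zeta>)\<^sup>2"
        unfolding cmod_power2 by (simp add: power2_eq_square algebra_simps)
      moreover have "v (L p + \<zeta> *\<^sub>C x) \<le> ereal (\<beta> + \<epsilon> * (cmod p)\<^sup>2 - u (L p)
          + u (L p + \<zeta> *\<^sub>C x) - \<epsilon> * (cmod (p + \<zeta>))\<^sup>2)"
        using v_le[of "p + \<zeta>"] that by (simp add: L_add)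
      ultimately show ?thesis by (simp add: algebra_simps)
    qed
    show False
      by (rule PSH_no_strict_touching[OF v G(1) Lp \<beta> \<open>open \<Omega>\<close> Lp_\<Omega> diff(1) diff(2)[OF Lp_\<Omega>]
          \<open>norm x = 1\<close> harm \<epsilon>(1) touch])
  qed
qed

end
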